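(* Let $\Gamma$ be a finite graph with at least one vertex, all of whose edges are labelled by $2$, and let $W_\Gamma$ be the associated right-angled Coxeter group. Then $W_\Gamma$ has Property (NL) if and only if $W_\Gamma$ is a finite group.
   Context: A Coxeter graph is a finite graph $\Gamma$ with vertices $s_1,\dots,s_n$ ($n\ge 1$) in which two distinct vertices $s_i,s_j$ may be joined by at most one edge (no loops), labelled by an integer $m_{ij}=m_{ji}\ge 2$. The associated Coxeter group $W_\Gamma$ has the presentation with generators $s_1,\dots,s_n$ and relations $s_i^2=1$ for all $i$, and $(s_is_j)^{m_{ij}}=1$ whenever $s_i$ and $s_j$ are joined by an edge labelled $m_{ij}$. (A missing edge means no relation between the two generators.) The group is right-angled if all edge labels equal $2$. A geodesic metric space $X$ is hyperbolic if there is $\delta\ge 0$ such that for all $x,y,z\in X$ and all geodesics $[x,y],[y,z],[x,z]$, the side $[x,z]$ is contained in the $\delta$-neighborhood of $[x,y]\cup[y,z]$. For an isometric action of a group $G$ on a (nonempty) hyperbolic space $X$, an element $g\in G$ is loxodromic if the map $\mathbb{Z}\to X$, $n\mapsto g^n x_0$, is a quasi-isometric embedding for some (equivalently, every) $x_0\in X$. Here a map $q:Y\to X$ of metric spaces is a quasi-isometric embedding if there is $C\ge 1$ with $\frac1C d_Y(a,b)-C\le d_X(q(a),q(b))\le C d_Y(a,b)+C$ for all $a,b\in Y$. A group $G$ has Property (NL) if for every isometric action of $G$ on every hyperbolic space, no element of $G$ is loxodromic. *)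

theory Defs
  imports "HOL-Analysis.Analysis" "HOL-Algebra.Group_Action"
begin

text \<open>A word over \<open>S\<close> is a list of letters; \<open>(s, True)\<close> stands for \<open>s\<close> and \<open>(s, False)\<close> for
  its formal inverse. The presented group is the set of words modulo the congruence generated by
  inserting and deleting pairs of adjacent mutually inverse letters and relators, that is, the
  free group on \<open>S\<close> modulo the normal closure of \<open>R\<close>.\<close>

type_synonym 'v word = "('v \<times> bool) list"

definition words :: "'v set \<Rightarrow> 'v word set" where
  "words S = lists (S \<times> UNIV)"

inductive_set presentation_rel :: "'v set \<Rightarrow> 'v word set \<Rightarrow> ('v word \<times> 'v word) set"
  for S :: "'v set" and R :: "'v word set" where
  refl: "w \<in> words S \<Longrightarrow> (w, w) \<in> presentation_rel S R"
| sym: "(v, w) \<in> presentation_rel S R \<Longrightarrow> (w, v) \<in> presentation_rel S R"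
| trans: "(u, v) \<in> presentation_rel S R \<Longrightarrow> (v, w) \<in> presentation_rel S R
    \<Longrightarrow> (u, w) \<in> presentation_rel S R"
| cancel: "u \<in> words S \<Longrightarrow> v \<in> words S \<Longrightarrow> s \<in> S
    \<Longrightarrow> (u @ [(s, b), (s, \<not> b)] @ v, u @ v) \<in> presentation_rel S R"
| relator: "u \<in> words S \<Longrightarrow> v \<in> words S \<Longrightarrow> r \<in> R
    \<Longrightarrow> (u @ r @ v, u @ v) \<in> presentation_rel S R"

definition presented_group :: "'v set \<Rightarrow> 'v word set \<Rightarrow> 'v word set monoid" where
  "presented_group S R =
     \<lparr>carrier = words S // presentation_rel S R,
      mult = (\<lambda>A B. \<Union>u\<in>A. \<Union>v\<in>B. presentation_rel S R `` {u @ v}),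
      one = presentation_rel S R `` {[]}\<rparr>"

lemma append_words [simp]: "u @ v \<in> words S \<longleftrightarrow> u \<in> words S \<and> v \<in> words S"
  by (auto simp: words_def)

lemma presentation_rel_words:
  assumes "R \<subseteq> words S" "(u, v) \<in> presentation_rel S R"
  shows "u \<in> words S \<and> v \<in> words S"
  using assms(2) by induction (use assms(1) in \<open>auto simp: words_def\<close>)

lemma equiv_presentation_rel:
  assumes "R \<subseteq> words S"
  shows "equiv (words S) (presentation_rel S R)"
proof (rule equivI)
  show "presentation_rel S R \<subseteq> words S \<times> words S"
    using presentation_rel_words[OF assms] by auto
  show "refl_on (words S) (presentation_rel S R)"
    by (rule refl_onI) (rule presentation_rel.refl)
  show "sym (presentation_rel S R)"
    by (rule symI) (rule presentation_rel.sym)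
  show "trans (presentation_rel S R)"
    by (rule transI) (rule presentation_rel.trans)
qed

lemma presentation_rel_append_right:
  assumes "(u, v) \<in> presentation_rel S R" "x \<in> words S"
  shows "(u @ x, v @ x) \<in> presentation_rel S R"
  using assms(1)
proof induction
  case (refl w)
  then show ?case using assms(2) by (auto intro: presentation_rel.refl)
next
  case (cancel u v s b)
  then show ?case using presentation_rel.cancel[of u S "v @ x"] assms(2) by simp
next
  case (relator u v r)
  then show ?case using presentation_rel.relator[of u S "v @ x"] assms(2) by simp
next
  case (sym v w)
  show ?case using sym.IH by (rule presentation_rel.sym)
next
  case (trans u v w)
  show ?case using trans.IH by (rule presentation_rel.trans)
qed

lemma presentation_rel_append_left:
  assumes "(u, v) \<in> presentation_rel S R" "x \<in> words S"
  shows "(x @ u, x @ v) \<in> presentation_rel S R"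
  using assms(1)
proof induction
  case (refl w)
  then show ?case using assms(2) by (auto intro: presentation_rel.refl)
next
  case (cancel u v s b)
  then show ?case using presentation_rel.cancel[of "x @ u" S v] assms(2) by simp
next
  case (relator u v r)
  then show ?case using presentation_rel.relator[of "x @ u" S v] assms(2) by simp
next
  case (sym v w)
  show ?case using sym.IH by (rule presentation_rel.sym)
next
  case (trans u v w)
  show ?case using trans.IH by (rule presentation_rel.trans)
qed

lemma mult_presented_group:
  assumes "R \<subseteq> words S" "u \<in> words S" "v \<in> words S"
  shows "(presentation_rel S R `` {u}) \<otimes>\<^bsub>presented_group S R\<^esub> (presentation_rel S R `` {v})
       = presentation_rel S R `` {u @ v}"
proof -
  let ?E = "presentation_rel S R"
  note eq = equiv_presentation_rel[OF assms(1)]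
  have cls: "?E `` {u' @ v'} = ?E `` {u @ v}" if "(u, u') \<in> ?E" "(v, v') \<in> ?E" for u' v'
  proof -
    have "(u @ v, u' @ v) \<in> ?E"
      using presentation_rel_append_right that(1) assms(3) .
    moreover have "(u' @ v, u' @ v') \<in> ?E"
      using presentation_rel_append_left that presentation_rel_words[OF assms(1)] by blast
    ultimately have "(u @ v, u' @ v') \<in> ?E"
      by (rule presentation_rel.trans)
    then show ?thesis
      by (rule equiv_class_eq[OF eq, symmetric])
  qed
  have self: "u \<in> ?E `` {u}" "v \<in> ?E `` {v}"
    using assms by (auto intro: presentation_rel.refl)
  have "(\<Union>u'\<in>?E `` {u}. \<Union>v'\<in>?E `` {v}. ?E `` {u' @ v'}) = ?E `` {u @ v}"
  proof
    show "(\<Union>u'\<in>?E `` {u}. \<Union>v'\<in>?E `` {v}. ?E `` {u' @ v'}) \<subseteq> ?E `` {u @ v}"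
    proof (intro UN_least)
      fix u' v' assume "u' \<in> ?E `` {u}" "v' \<in> ?E `` {v}"
      then show "?E `` {u' @ v'} \<subseteq> ?E `` {u @ v}" by (simp only: Image_singleton_iff cls order_refl)
    qed
    show "?E `` {u @ v} \<subseteq> (\<Union>u'\<in>?E `` {u}. \<Union>v'\<in>?E `` {v}. ?E `` {u' @ v'})"
      using self by fast
  qed
  then show ?thesis
    by (simp only: presented_group_def monoid.simps)
qed

lemma group_presented_group:
  assumes "R \<subseteq> words S"
  shows "group (presented_group S R)"
proof -
  let ?E = "presentation_rel S R" and ?G = "presented_group S R"
  have car: "carrier ?G = words S // ?E" and one: "\<one>\<^bsub>?G\<^esub> = ?E `` {[]}"
    by (simp_all add: presented_group_def)
  have nil: "[] \<in> words S" by (simp add: words_def)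
  note m = mult_presented_group[OF assms]
  have inv: "\<exists>w'\<in>words S. (w' @ w, []) \<in> ?E" if "w \<in> words S" for w
    using that
  proof (induction w)
    case Nil
    then show ?case by (auto intro: presentation_rel.refl nil)
  next
    case (Cons x w)
    obtain s b where x: "x = (s, b)" by (cases x)
    have w: "w \<in> words S" and s: "s \<in> S" using Cons.prems x by (auto simp: words_def)
    obtain w' where w': "w' \<in> words S" "(w' @ w, []) \<in> ?E" using Cons.IH w by blast
    have "(w' @ [(s, \<not> b), (s, \<not> \<not> b)] @ w, w' @ w) \<in> ?E"
      by (rule presentation_rel.cancel) (use w w' s in auto)
    then have "((w' @ [(s, \<not> b)]) @ x # w, []) \<in> ?E"
      using w'(2) x by (auto intro: presentation_rel.trans)
    moreover have "w' @ [(s, \<not> b)] \<in> words S" using w'(1) s by (simp add: words_def)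
    ultimately show ?case by blast
  qed
  show ?thesis
  proof (rule groupI)
    show "\<one>\<^bsub>?G\<^esub> \<in> carrier ?G"
      unfolding car one using nil by (rule quotientI)
  next
    fix A assume "A \<in> carrier ?G"
    then obtain w where w: "w \<in> words S" "A = ?E `` {w}" unfolding car by (elim quotientE)
    then show "\<one>\<^bsub>?G\<^esub> \<otimes>\<^bsub>?G\<^esub> A = A" by (simp add: one m nil)
    obtain w' where w': "w' \<in> words S" "(w' @ w, []) \<in> ?E" using inv w(1) by blast
    then have "?E `` {w'} \<otimes>\<^bsub>?G\<^esub> A = \<one>\<^bsub>?G\<^esub>"
      by (simp add: w m one equiv_class_eq[OF equiv_presentation_rel[OF assms]])
    then show "\<exists>B\<in>carrier ?G. B \<otimes>\<^bsub>?G\<^esub> A = \<one>\<^bsub>?G\<^esub>"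
      unfolding car using w'(1) by (blast intro: quotientI)
  next
    fix A B assume "A \<in> carrier ?G" "B \<in> carrier ?G"
    then obtain u v where "u \<in> words S" "A = ?E `` {u}" "v \<in> words S" "B = ?E `` {v}"
      unfolding car by (elim quotientE)
    then show "A \<otimes>\<^bsub>?G\<^esub> B \<in> carrier ?G" by (simp add: car m quotientI)
  next
    fix A B C assume "A \<in> carrier ?G" "B \<in> carrier ?G" "C \<in> carrier ?G"
    then obtain u v w where "u \<in> words S" "A = ?E `` {u}" "v \<in> words S" "B = ?E `` {v}"
      "w \<in> words S" "C = ?E `` {w}"
      unfolding car by (elim quotientE)
    then show "A \<otimes>\<^bsub>?G\<^esub> B \<otimes>\<^bsub>?G\<^esub> C = A \<otimes>\<^bsub>?G\<^esub> (B \<otimes>\<^bsub>?G\<^esub> C)" by (simp add: m)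
  qed
qed

text \<open>Edges are two-element sets of vertices; the label function \<open>m\<close> is only relevant on \<open>E\<close>.\<close>

definition coxeter_graph :: "'v set \<Rightarrow> 'v set set \<Rightarrow> ('v set \<Rightarrow> nat) \<Rightarrow> bool" where
  "coxeter_graph V E m \<longleftrightarrow> finite V \<and> V \<noteq> {} \<and>
     (\<forall>e\<in>E. e \<subseteq> V \<and> card e = 2) \<and> (\<forall>e\<in>E. m e \<ge> 2)"

definition right_angled :: "'v set set \<Rightarrow> ('v set \<Rightarrow> nat) \<Rightarrow> bool" where
  "right_angled E m \<longleftrightarrow> (\<forall>e\<in>E. m e = 2)"

definition coxeter_relators :: "'v set \<Rightarrow> 'v set set \<Rightarrow> ('v set \<Rightarrow> nat) \<Rightarrow> 'v word set" where
  "coxeter_relators V E m =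
     {[(s, True), (s, True)] | s. s \<in> V} \<union>
     {concat (replicate (m {s, t}) [(s, True), (t, True)]) | s t. {s, t} \<in> E}"

definition coxeter_group :: "'v set \<Rightarrow> 'v set set \<Rightarrow> ('v set \<Rightarrow> nat) \<Rightarrow> 'v word set monoid" where
  "coxeter_group V E m = presented_group V (coxeter_relators V E m)"

lemma coxeter_relators_subset_words:
  assumes "coxeter_graph V E m"
  shows "coxeter_relators V E m \<subseteq> words V"
proof -
  have "concat (replicate n [(s, True), (t, True)]) \<in> words V" if "{s, t} \<in> E" for n s t
  proof -
    have "s \<in> V" "t \<in> V" using assms that unfolding coxeter_graph_def by blast+
    then show ?thesis by (induction n) (simp_all add: words_def)
  qed
  moreover have "[(s, True), (s, True)] \<in> words V" if "s \<in> V" for s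
    using that by (simp add: words_def)
  ultimately show ?thesis unfolding coxeter_relators_def by blast
qed

lemma group_coxeter_group: "coxeter_graph V E m \<Longrightarrow> group (coxeter_group V E m)"
  unfolding coxeter_group_def by (intro group_presented_group coxeter_relators_subset_words)

definition geodesic_path ::
    "'x set \<Rightarrow> ('x \<Rightarrow> 'x \<Rightarrow> real) \<Rightarrow> 'x \<Rightarrow> 'x \<Rightarrow> (real \<Rightarrow> 'x) \<Rightarrow> bool" where
  "geodesic_path X d x y \<gamma> \<longleftrightarrow>
     \<gamma> \<in> {0..d x y} \<rightarrow> X \<and> \<gamma> 0 = x \<and> \<gamma> (d x y) = y \<and>
     (\<forall>a\<in>{0..d x y}. \<forall>b\<in>{0..d x y}. d (\<gamma> a) (\<gamma> b) = \<bar>a - b\<bar>)"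

definition geodesic_segment ::
    "'x set \<Rightarrow> ('x \<Rightarrow> 'x \<Rightarrow> real) \<Rightarrow> 'x \<Rightarrow> 'x \<Rightarrow> 'x set \<Rightarrow> bool" where
  "geodesic_segment X d x y A \<longleftrightarrow> (\<exists>\<gamma>. geodesic_path X d x y \<gamma> \<and> A = \<gamma> ` {0..d x y})"

definition geodesic_space :: "'x set \<Rightarrow> ('x \<Rightarrow> 'x \<Rightarrow> real) \<Rightarrow> bool" where
  "geodesic_space X d \<longleftrightarrow>
     Metric_space X d \<and> (\<forall>x\<in>X. \<forall>y\<in>X. \<exists>A. geodesic_segment X d x y A)"

text \<open>The neighborhood is taken closed: an open one would be empty for \<open>\<delta> = 0\<close>. As \<open>\<delta>\<close> is
  existentially quantified, this makes no other difference.\<close>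

definition hyperbolic_space :: "'x set \<Rightarrow> ('x \<Rightarrow> 'x \<Rightarrow> real) \<Rightarrow> bool" where
  "hyperbolic_space X d \<longleftrightarrow> geodesic_space X d \<and>
     (\<exists>\<delta>\<ge>0. \<forall>x\<in>X. \<forall>y\<in>X. \<forall>z\<in>X. \<forall>A B C.
        geodesic_segment X d x y A \<longrightarrow> geodesic_segment X d y z B \<longrightarrow> geodesic_segment X d x z C \<longrightarrow>
        (\<forall>p\<in>C. \<exists>q\<in>A \<union> B. d p q \<le> \<delta>))"

definition quasi_isometric_embedding ::
    "'y set \<Rightarrow> ('y \<Rightarrow> 'y \<Rightarrow> real) \<Rightarrow> 'x set \<Rightarrow> ('x \<Rightarrow> 'x \<Rightarrow> real) \<Rightarrow> ('y \<Rightarrow> 'x) \<Rightarrow> bool" where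
  "quasi_isometric_embedding Y dY X dX q \<longleftrightarrow> q \<in> Y \<rightarrow> X \<and>
     (\<exists>C\<ge>1. \<forall>a\<in>Y. \<forall>b\<in>Y. 1 / C * dY a b - C \<le> dX (q a) (q b) \<and> dX (q a) (q b) \<le> C * dY a b + C)"

definition isometric_action ::
    "('g, 'm) monoid_scheme \<Rightarrow> 'x set \<Rightarrow> ('x \<Rightarrow> 'x \<Rightarrow> real) \<Rightarrow> ('g \<Rightarrow> 'x \<Rightarrow> 'x) \<Rightarrow> bool" where
  "isometric_action G X d \<phi> \<longleftrightarrow> group_action G X \<phi> \<and>
     (\<forall>g\<in>carrier G. \<forall>x\<in>X. \<forall>y\<in>X. d (\<phi> g x) (\<phi> g y) = d x y)"

definition loxodromic ::
    "('g, 'm) monoid_scheme \<Rightarrow> 'x set \<Rightarrow> ('x \<Rightarrow> 'x \<Rightarrow> real) \<Rightarrow> ('g \<Rightarrow> 'x \<Rightarrow> 'x) \<Rightarrow> 'g \<Rightarrow> bool" where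
  "loxodromic G X d \<phi> g \<longleftrightarrow>
     (\<exists>x\<in>X. quasi_isometric_embedding UNIV (dist :: int \<Rightarrow> int \<Rightarrow> real) X d
        (\<lambda>n. \<phi> (g [^]\<^bsub>G\<^esub> n) x))"

text \<open>HOL cannot quantify over types inside a formula, so the property is relative to a type
  \<open>'x\<close>: it speaks of all hyperbolic spaces whose underlying set is a subset of \<open>'x\<close>, with an
  arbitrary metric.\<close>

definition property_NL :: "'x itself \<Rightarrow> ('g, 'm) monoid_scheme \<Rightarrow> bool" where
  "property_NL (T :: 'x itself) G \<longleftrightarrow>
     (\<forall>(X :: 'x set) d \<phi>. X \<noteq> {} \<longrightarrow> hyperbolic_space X d \<longrightarrow> isometric_action G X d \<phi> \<longrightarrow>
        (\<forall>g\<in>carrier G. \<not> loxodromic G X d \<phi> g))"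

end

theory Submission
  imports Defs "HOL-Algebra.Multiplicative_Group"
begin

text \<open>Finiteness is decided by the graph: \<open>W\<close> is finite if \<open>\<Gamma>\<close> is complete, and \<open>W\<close> maps onto the
  infinite dihedral group otherwise.

  If all generators commute, a letter occurring twice in a word can be moved next to its other
  occurrence and cancelled, so every element is represented by a word without repeated letters
  (\<open>right_angled_complete_finite\<close>). If two generators \<open>s\<close> and \<open>t\<close> are not joined, let \<open>s\<close> and \<open>t\<close>
  act on the real line by the reflections in \<open>0\<close> and \<open>1/2\<close>, and let the other generators act
  trivially. Every relator then acts as the identity, since no commutation relator involves both
  \<open>s\<close> and \<open>t\<close>, so the action extends to \<open>W\<close> (\<open>group_action_presented_group\<close>), and \<open>st\<close> acts as a unit translation.
  The real line is a tree, hence hyperbolic with \<open>\<delta> = 0\<close>, and translations are loxodromic: \<open>W\<close>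
  fails Property (NL), already on a space carried by the reals
  (\<open>right_angled_non_edge_not_NL\<close>). Conversely, an element of finite order is never loxodromic because
  its powers return to the base point infinitely often (\<open>finite_property_NL\<close>).\<close>

section \<open>Finite groups have Property (NL)\<close>

text \<open>The lower bound of the quasi-isometric embedding fails along the exponents \<open>n * order G\<close>, where
  the orbit is back at its start while the exponents grow without bound.\<close>

lemma finite_property_NL:
  fixes G :: "('g, 'm) monoid_scheme"
  assumes "group G" and fin: "finite (carrier G)"
  shows "property_NL TYPE('x) G"
  unfolding property_NL_def
proof (intro allI impI ballI notI)
  fix X :: "'x set" and d \<phi> g
  assume hyp: "hyperbolic_space X d" and act: "isometric_action G X d \<phi>" and g: "g \<in> carrier G"
    and lox: "loxodromic G X d \<phi> g"
  interpret group G by fact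
  interpret group_action G X \<phi> using act by (simp add: isometric_action_def)
  interpret Metric_space X d using hyp by (simp add: hyperbolic_space_def geodesic_space_def)
  obtain x where x: "x \<in> X" and emb: "quasi_isometric_embedding UNIV (dist :: int \<Rightarrow> int \<Rightarrow> real) X d
      (\<lambda>n. \<phi> (g [^]\<^bsub>G\<^esub> n) x)"
    using lox unfolding loxodromic_def by (elim bexE)
  obtain C where C: "C \<ge> 1"
    and qi: "\<And>a b. 1 / C * real_of_int \<bar>a - b\<bar> - C \<le> d (\<phi> (g [^]\<^bsub>G\<^esub> a) x) (\<phi> (g [^]\<^bsub>G\<^esub> b) x)"
    using emb unfolding quasi_isometric_embedding_def by (auto simp: dist_of_int)
  have return: "\<phi> (g [^]\<^bsub>G\<^esub> int (order G * n)) x = x" for n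
  proof -
    have "g [^]\<^bsub>G\<^esub> int (order G * n) = (g [^]\<^bsub>G\<^esub> order G) [^]\<^bsub>G\<^esub> n"
      using g by (simp only: int_pow_int nat_pow_pow)
    also have "\<dots> = \<one>\<^bsub>G\<^esub>" using g by (simp add: pow_order_eq_1)
    finally show ?thesis using x id_eq_one by (metis restrict_apply')
  qed
  obtain n :: nat where n: "real n > C * C" using reals_Archimedean2 by blast
  have "1 / C * real_of_int \<bar>int (order G * n) - 0\<bar> - C \<le> 0"
    using qi[of "int (order G * n)" 0] return[of n] return[of 0] x by simp
  then have "real (order G) * real n \<le> C * C"
    using C by (simp add: field_simps)
  moreover have "order G \<ge> 1" using order_gt_0_iff_finite fin by (simp add: Suc_leI)
  then have "real n \<le> real (order G) * real n" by (simp add: mult_le_cancel_right1)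
  ultimately show False using n by linarith
qed

section \<open>Commuting involutions generate a finite group\<close>

lemma presentation_rel_context:
  assumes "(x, y) \<in> presentation_rel S R" "u \<in> words S" "v \<in> words S"
  shows "(u @ x @ v, u @ y @ v) \<in> presentation_rel S R"
  by (intro presentation_rel_append_left presentation_rel_append_right assms)

text \<open>Only \<open>ss\<close> with two positive letters is a relator; putting it in front of the formal inverse
  of \<open>s\<close> and cancelling shows that this inverse equals \<open>s\<close>, so signs can be ignored.\<close>

lemma involution_words:
  assumes R: "R \<subseteq> words S" and s: "s \<in> S" and sq: "[(s, True), (s, True)] \<in> R"
  shows "([(s, b), (s, c)], []) \<in> presentation_rel S R"
    and "([(s, b)], [(s, True)]) \<in> presentation_rel S R"
proof -
  note tr = presentation_rel.trans
  have nil: "[] \<in> words S" and sb: "[(s, b)] \<in> words S" for b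
    using s by (auto simp: words_def)
  have 1: "([(s, True), (s, True)] @ [(s, False)], [(s, False)]) \<in> presentation_rel S R"
    using presentation_rel.relator[OF nil sb sq] by simp
  have 2: "([(s, True)] @ [(s, True), (s, \<not> True)] @ [], [(s, True)] @ []) \<in> presentation_rel S R"
    by (rule presentation_rel.cancel[OF sb nil s])
  have F: "([(s, False)], [(s, True)]) \<in> presentation_rel S R"
    using tr[OF presentation_rel.sym[OF 1]] 2 by simp
  show norm: "([(s, b)], [(s, True)]) \<in> presentation_rel S R" for b
    using F presentation_rel.refl[OF sb] by (cases b) auto
  have "([(s, b)] @ [(s, c)], [(s, True)] @ [(s, c)]) \<in> presentation_rel S R"
    by (rule presentation_rel_append_right[OF norm sb])
  moreover have "([(s, True)] @ [(s, c)], [(s, True)] @ [(s, True)]) \<in> presentation_rel S R"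
    by (rule presentation_rel_append_left[OF norm sb])
  moreover have "([(s, True)] @ [(s, True)], []) \<in> presentation_rel S R"
    using presentation_rel.relator[OF nil nil sq] by simp
  ultimately show "([(s, b), (s, c)], []) \<in> presentation_rel S R"
    by (auto intro: tr)
qed

text \<open>Putting the relator \<open>stst\<close> in front of \<open>ts\<close> gives a word that reduces to \<open>st\<close> by cancelling \<open>tt\<close>
  and then \<open>ss\<close>.\<close>

lemma commuting_letters:
  assumes R: "R \<subseteq> words S" and st: "s \<in> S" "t \<in> S"
    and sq: "[(s, True), (s, True)] \<in> R" "[(t, True), (t, True)] \<in> R"
    and comm: "[(s, True), (t, True), (s, True), (t, True)] \<in> R"
  shows "([(s, b), (t, c)], [(t, c), (s, b)]) \<in> presentation_rel S R"
proof -
  let ?E = "presentation_rel S R"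
  note tr = presentation_rel.trans and sy = presentation_rel.sym
  let ?s = "(s, True)" and ?t = "(t, True)"
  have w: "[] \<in> words S" "[(s, e)] \<in> words S" "[(t, e)] \<in> words S"
    "[?s, ?t, ?s] \<in> words S" "[?s, ?t] \<in> words S" "[?t, ?s] \<in> words S" for e
    using st by (auto simp: words_def)
  have 1: "([?s, ?t, ?s, ?t, ?t, ?s], [?t, ?s]) \<in> ?E"
    using presentation_rel.relator[OF w(1) w(6) comm] by simp
  have 2: "([?s, ?t, ?s, ?t, ?t, ?s], [?s, ?t, ?s, ?s]) \<in> ?E"
    using presentation_rel.relator[OF w(4) w(2) sq(2)] by simp
  have 3: "([?s, ?t, ?s, ?s], [?s, ?t]) \<in> ?E"
    using presentation_rel.relator[OF w(5) w(1) sq(1)] by simp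
  have core: "([?s, ?t], [?t, ?s]) \<in> ?E"
    using tr[OF tr[OF sy[OF 3] sy[OF 2]] 1] .
  have norm: "([(s, b)], [?s]) \<in> ?E" "([(t, c)], [?t]) \<in> ?E"
    using involution_words(2) R st sq by metis+
  have "([(s, b)] @ [(t, c)], [?s] @ [?t]) \<in> ?E"
    using tr[OF presentation_rel_append_right[OF norm(1) w(3)]
                presentation_rel_append_left[OF norm(2) w(2)]] .
  moreover have "([(t, c)] @ [(s, b)], [?t] @ [?s]) \<in> ?E"
    using tr[OF presentation_rel_append_right[OF norm(2) w(2)]
                presentation_rel_append_left[OF norm(1) w(3)]] .
  ultimately show ?thesis using tr[OF tr[OF _ core] sy] by simp
qed

lemma letter_commutes_with_word:
  assumes R: "R \<subseteq> words S" and x: "fst x \<in> S"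
    and comm: "\<And>y. fst y \<in> S \<Longrightarrow> ([x, y], [y, x]) \<in> presentation_rel S R"
    and "v \<in> words S"
  shows "(x # v, v @ [x]) \<in> presentation_rel S R"
  using \<open>v \<in> words S\<close>
proof (induction v)
  case Nil
  have "[x] \<in> words S" using x by (cases x) (simp add: words_def)
  then show ?case by (simp add: presentation_rel.refl)
next
  case (Cons y v)
  then have v: "v \<in> words S" "[y] \<in> words S" "fst y \<in> S" by (auto simp: words_def)
  have "([x, y] @ v, [y, x] @ v) \<in> presentation_rel S R"
    by (rule presentation_rel_append_right[OF comm[OF v(3)] v(1)])
  moreover have "([y] @ (x # v), [y] @ (v @ [x])) \<in> presentation_rel S R"
    by (rule presentation_rel_append_left[OF Cons.IH[OF v(1)] v(2)])
  ultimately show ?case by (auto intro: presentation_rel.trans)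
qed

text \<open>A word in which a generator occurs twice is equivalent to the word with both occurrences
  removed, so a shortest representative has no repetition.\<close>

lemma equivalent_distinct_word:
  assumes R: "R \<subseteq> words S"
    and inv: "\<And>s b c. s \<in> S \<Longrightarrow> ([(s, b), (s, c)], []) \<in> presentation_rel S R"
    and comm: "\<And>x y. fst x \<in> S \<Longrightarrow> fst y \<in> S \<Longrightarrow> ([x, y], [y, x]) \<in> presentation_rel S R"
    and "w \<in> words S"
  shows "\<exists>w'\<in>words S. distinct (map fst w') \<and> (w, w') \<in> presentation_rel S R"
  using \<open>w \<in> words S\<close>
proof (induction w rule: length_induct)
  case (1 w)
  show ?case
  proof (cases "distinct (map fst w)")
    case True
    then show ?thesis using 1 presentation_rel.refl by blast
  next
    case False
    then obtain p q r s where "map fst w = p @ [s] @ q @ [s] @ r"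
      using not_distinct_decomp by blast
    then obtain p' q' r' b c where w: "w = p' @ [(s, b)] @ q' @ [(s, c)] @ r'"
      by (auto simp: map_eq_append_conv append_eq_map_conv map_eq_Cons_conv Cons_eq_map_conv)
    then have ws: "p' \<in> words S" "q' \<in> words S" "r' \<in> words S" "s \<in> S"
      "[(s, c)] \<in> words S" "[(s, c)] @ r' \<in> words S" "p' @ q' \<in> words S"
      using 1(2) by (auto simp: words_def)
    have "((s, b) # q', q' @ [(s, b)]) \<in> presentation_rel S R"
      by (rule letter_commutes_with_word[OF R _ _ ws(2)]) (simp_all add: ws(4) comm)
    then have "(p' @ ((s, b) # q') @ [(s, c)] @ r', p' @ (q' @ [(s, b)]) @ [(s, c)] @ r')
        \<in> presentation_rel S R"
      by (rule presentation_rel_context[OF _ ws(1,6)])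
    moreover have "((p' @ q') @ [(s, b), (s, c)] @ r', (p' @ q') @ [] @ r') \<in> presentation_rel S R"
      by (rule presentation_rel_context[OF inv[OF ws(4)] ws(7,3)])
    ultimately have "(w, p' @ q' @ r') \<in> presentation_rel S R"
      using w by (auto intro: presentation_rel.trans)
    moreover have "length (p' @ q' @ r') < length w" "p' @ q' @ r' \<in> words S"
      using w ws by auto
    then obtain w' where "w' \<in> words S" "distinct (map fst w')"
        "(p' @ q' @ r', w') \<in> presentation_rel S R"
      using 1(1) by blast
    ultimately show ?thesis using presentation_rel.trans by blast
  qed
qed

text \<open>Representatives without repeated generators have at most \<open>card V\<close> letters from a finite
  alphabet.\<close>

lemma right_angled_complete_finite:
  assumes graph: "coxeter_graph V E m" and ra: "right_angled E m"
    and complete: "\<And>s t. s \<in> V \<Longrightarrow> t \<in> V \<Longrightarrow> s \<noteq> t \<Longrightarrow> {s, t} \<in> E"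
  shows "finite (carrier (coxeter_group V E m))"
proof -
  let ?R = "coxeter_relators V E m"
  let ?E = "presentation_rel V ?R"
  note R = coxeter_relators_subset_words[OF graph]
  have sq: "[(s, True), (s, True)] \<in> ?R" if "s \<in> V" for s
    using that by (auto simp: coxeter_relators_def)
  have inv: "([(s, b), (s, c)], []) \<in> ?E" if "s \<in> V" for s b c
    by (rule involution_words(1)[OF R that sq[OF that]])
  have comm: "([x, y], [y, x]) \<in> ?E" if "fst x \<in> V" "fst y \<in> V" for x y
  proof (cases "fst x = fst y")
    case True
    then have "([x, y], []) \<in> ?E" "([y, x], []) \<in> ?E"
      using inv[of "fst x" "snd x" "snd y"] inv[of "fst x" "snd y" "snd x"] that
      by (metis prod.collapse)+
    then show ?thesis using presentation_rel.trans presentation_rel.sym by metis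
  next
    case False
    then have e: "{fst x, fst y} \<in> E" using complete that by blast
    have "concat (replicate (m {fst x, fst y}) [(fst x, True), (fst y, True)]) \<in> ?R"
      using e unfolding coxeter_relators_def by blast
    moreover have "m {fst x, fst y} = Suc (Suc 0)" using e ra by (simp add: right_angled_def)
    ultimately have "[(fst x, True), (fst y, True), (fst x, True), (fst y, True)] \<in> ?R" by simp
    from commuting_letters[OF R that sq[OF that(1)] sq[OF that(2)] this, of "snd x" "snd y"]
    show ?thesis by simp
  qed
  have finV: "finite V" using graph by (simp add: coxeter_graph_def)
  let ?D = "{w \<in> words V. distinct (map fst w)}"
  have "?D \<subseteq> {w. set w \<subseteq> V \<times> UNIV \<and> length w \<le> card V}"
  proof
    fix w assume "w \<in> ?D"
    then have w: "set w \<subseteq> V \<times> UNIV" "distinct (map fst w)" by (auto simp: words_def)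
    then have "length w = card (fst ` set w)" by (metis distinct_card length_map set_map)
    also have "\<dots> \<le> card V" using w(1) finV by (intro card_mono) auto
    finally show "w \<in> {w. set w \<subseteq> V \<times> UNIV \<and> length w \<le> card V}" using w(1) by simp
  qed
  then have "finite ?D"
    by (rule finite_subset) (intro finite_lists_length_le finite_SigmaI finV finite)
  moreover have "carrier (coxeter_group V E m) \<subseteq> (\<lambda>w. ?E `` {w}) ` ?D"
  proof
    fix A assume "A \<in> carrier (coxeter_group V E m)"
    then obtain w where w: "w \<in> words V" "A = ?E `` {w}"
      by (auto simp: coxeter_group_def presented_group_def elim: quotientE)
    then obtain w' where "w' \<in> ?D" "(w, w') \<in> ?E"
      using equivalent_distinct_word[OF R inv comm w(1)] by blast
    then show "A \<in> (\<lambda>w. ?E `` {w}) ` ?D"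
      using w(2) equiv_class_eq[OF equiv_presentation_rel[OF R]] by blast
  qed
  ultimately show ?thesis using finite_surj by blast
qed

section \<open>Actions of presented groups\<close>

definition word_action :: "('v \<Rightarrow> 'x \<Rightarrow> 'x) \<Rightarrow> 'v word \<Rightarrow> 'x \<Rightarrow> 'x" where
  "word_action f = foldr (\<lambda>(s, b). if b then f s else inv_into UNIV (f s))"

lemma word_action_Nil: "word_action f [] = id"
  by (simp add: word_action_def id_def)

lemma word_action_Cons:
  "word_action f ((s, b) # w) = (if b then f s else inv_into UNIV (f s)) \<circ> word_action f w"
  by (simp add: word_action_def)

lemma word_action_append: "word_action f (u @ v) = word_action f u \<circ> word_action f v"
  by (simp add: word_action_def fun_eq_iff)

lemma bij_word_action:
  assumes "\<And>s. s \<in> S \<Longrightarrow> bij (f s)" "w \<in> words S"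
  shows "bij (word_action f w)"
  using assms(2)
proof (induction w)
  case Nil
  show ?case by (simp only: word_action_Nil bij_id)
next
  case (Cons x w)
  obtain s b where x: "x = (s, b)" by (cases x)
  then have sw: "s \<in> S" "w \<in> words S" using Cons.prems by (auto simp: words_def)
  then have "bij (if b then f s else inv_into UNIV (f s))"
    using assms(1) bij_imp_bij_inv by auto
  then show ?case unfolding x word_action_Cons by (rule bij_comp[OF Cons.IH[OF sw(2)]])
qed

lemma word_action_cong:
  assumes bij: "\<And>s. s \<in> S \<Longrightarrow> bij (f s)" and rel: "\<And>r. r \<in> R \<Longrightarrow> word_action f r = id"
    and "(u, v) \<in> presentation_rel S R"
  shows "word_action f u = word_action f v"
  using assms(3)
proof induction
  case (cancel u v s b)
  then have "word_action f [(s, b), (s, \<not> b)] = id"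
    using bij[of s] by (cases b)
      (auto simp: word_action_Cons word_action_Nil fun_eq_iff bij_is_surj bij_is_inj surj_f_inv_f)
  then show ?case by (simp only: word_action_append) simp
qed (simp_all add: word_action_append rel)

definition presented_action :: "('v \<Rightarrow> 'x \<Rightarrow> 'x) \<Rightarrow> 'v word set \<Rightarrow> 'x \<Rightarrow> 'x" where
  "presented_action f A = word_action f (SOME w. w \<in> A)"

lemma presented_action_class:
  assumes R: "R \<subseteq> words S" and bij: "\<And>s. s \<in> S \<Longrightarrow> bij (f s)"
    and rel: "\<And>r. r \<in> R \<Longrightarrow> word_action f r = id" and w: "w \<in> words S"
  shows "presented_action f (presentation_rel S R `` {w}) = word_action f w"
proof -
  have "w \<in> presentation_rel S R `` {w}" using w by (simp add: presentation_rel.refl)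
  then have "(w, SOME v. v \<in> presentation_rel S R `` {w}) \<in> presentation_rel S R"
    by (metis Image_singleton_iff someI)
  then show ?thesis
    unfolding presented_action_def using word_action_cong[OF bij rel] by metis
qed

text \<open>This is von Dyck's theorem for homomorphisms into the symmetric group of a type.\<close>

lemma group_action_presented_group:
  fixes f :: "'v \<Rightarrow> 'x \<Rightarrow> 'x"
  assumes R: "R \<subseteq> words S" and bij: "\<And>s. s \<in> S \<Longrightarrow> bij (f s)"
    and rel: "\<And>r. r \<in> R \<Longrightarrow> word_action f r = id"
  shows "group_action (presented_group S R) UNIV (presented_action f)"
proof -
  let ?G = "presented_group S R"
  note cls = presented_action_class[OF R bij rel]
  have rep: "\<exists>w\<in>words S. A = presentation_rel S R `` {w}" if "A \<in> carrier ?G" for A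
    using that by (auto simp: presented_group_def elim: quotientE)
  have "presented_action f \<in> hom ?G (BijGroup UNIV)"
  proof (rule homI)
    fix A assume "A \<in> carrier ?G"
    then obtain w where "w \<in> words S" "A = presentation_rel S R `` {w}" using rep by blast
    then show "presented_action f A \<in> carrier (BijGroup UNIV)"
      using bij_word_action[of S f w] bij cls by (simp add: BijGroup_def Bij_def)
  next
    fix A B assume AB: "A \<in> carrier ?G" "B \<in> carrier ?G"
    then obtain u v where uv: "u \<in> words S" "A = presentation_rel S R `` {u}"
      "v \<in> words S" "B = presentation_rel S R `` {v}" using rep by meson
    have "presented_action f A \<in> Bij UNIV" "presented_action f B \<in> Bij UNIV"
      using bij_word_action[of S f] bij cls uv by (simp_all add: Bij_def)
    then show "presented_action f (A \<otimes>\<^bsub>?G\<^esub> B)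
        = presented_action f A \<otimes>\<^bsub>BijGroup UNIV\<^esub> presented_action f B"
      using uv by (simp add: mult_presented_group[OF R] cls word_action_append BijGroup_def
          compose_def fun_eq_iff)
  qed
  then show ?thesis
    using group_presented_group[OF R] group_BijGroup
    by (simp add: group_action_def group_hom_def group_hom_axioms_def)
qed

lemma isometric_action_presented_group:
  fixes f :: "'v \<Rightarrow> 'x :: metric_space \<Rightarrow> 'x"
  assumes R: "R \<subseteq> words S" and bij: "\<And>s. s \<in> S \<Longrightarrow> bij (f s)"
    and iso: "\<And>s x y. s \<in> S \<Longrightarrow> dist (f s x) (f s y) = dist x y"
    and rel: "\<And>r. r \<in> R \<Longrightarrow> word_action f r = id"
  shows "isometric_action (presented_group S R) UNIV dist (presented_action f)"
  unfolding isometric_action_def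
proof (intro conjI ballI)
  show "group_action (presented_group S R) UNIV (presented_action f)"
    by (rule group_action_presented_group[OF R bij rel])
  fix A x y assume "A \<in> carrier (presented_group S R)"
  then obtain w where w: "w \<in> words S" "A = presentation_rel S R `` {w}"
    by (auto simp: presented_group_def elim: quotientE)
  have inv_iso: "dist (inv_into UNIV (f s) x) (inv_into UNIV (f s) y) = dist x y" if "s \<in> S" for s x y
    using iso[OF that, of "inv_into UNIV (f s) x" "inv_into UNIV (f s) y"] bij[OF that]
    by (simp add: bij_is_surj surj_f_inv_f)
  have "dist (word_action f w x) (word_action f w y) = dist x y"
    using w(1)
  proof (induction w)
    case Nil
    then show ?case by (simp add: word_action_Nil)
  next
    case (Cons p w)
    then show ?case
      by (cases p) (auto simp: word_action_Cons iso inv_iso words_def)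
  qed
  then show "dist (presented_action f A x) (presented_action f A y) = dist x y"
    using w presented_action_class[OF R bij rel] by simp
qed

section \<open>The real line\<close>

text \<open>A point of the line is determined by its distances to two distinct points, so geodesics in the
  line are unique and every triangle is degenerate: each side is covered by the other two.\<close>

lemma geodesic_segment_real:
  fixes x y :: real
  assumes "geodesic_segment UNIV dist x y A"
  shows "A = {min x y..max x y}"
proof -
  obtain \<gamma> where \<gamma>: "\<gamma> 0 = x" "\<gamma> \<bar>x - y\<bar> = y" "A = \<gamma> ` {0..\<bar>x - y\<bar>}"
    and iso: "\<And>a b. a \<in> {0..\<bar>x - y\<bar>} \<Longrightarrow> b \<in> {0..\<bar>x - y\<bar>} \<Longrightarrow> \<bar>\<gamma> a - \<gamma> b\<bar> = \<bar>a - b\<bar>"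
    using assms unfolding geodesic_segment_def geodesic_path_def dist_real_def by blast
  have dists: "\<bar>\<gamma> a - x\<bar> = a" "\<bar>\<gamma> a - y\<bar> = \<bar>x - y\<bar> - a" if "a \<in> {0..\<bar>x - y\<bar>}" for a
    using iso[of a 0] iso[of a "\<bar>x - y\<bar>"] \<gamma>(1,2) that by auto
  show ?thesis
  proof
    show "A \<subseteq> {min x y..max x y}"
    proof
      fix p assume "p \<in> A"
      then obtain a where "a \<in> {0..\<bar>x - y\<bar>}" "p = \<gamma> a" using \<gamma>(3) by blast
      then show "p \<in> {min x y..max x y}" using dists[of a] by (auto simp: min_def max_def)
    qed
    show "{min x y..max x y} \<subseteq> A"
    proof
      fix p assume p: "p \<in> {min x y..max x y}"
      then have a: "\<bar>p - x\<bar> \<in> {0..\<bar>x - y\<bar>}" by (auto simp: min_def max_def split: if_splits)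
      have "\<gamma> \<bar>p - x\<bar> = p"
      proof (cases "x \<le> y")
        case True
        then have "x \<le> p" "p \<le> y" using p by auto
        then show ?thesis using dists[OF a] by arith
      next
        case False
        then have "y \<le> p" "p \<le> x" using p by auto
        then show ?thesis using dists[OF a] by arith
      qed
      then show "p \<in> A" using a \<gamma>(3) by (metis image_eqI)
    qed
  qed
qed

lemma hyperbolic_space_real: "hyperbolic_space UNIV (dist :: real \<Rightarrow> real \<Rightarrow> real)"
proof -
  have "\<exists>A. geodesic_segment UNIV dist x y A" for x y :: real
  proof -
    have "geodesic_path UNIV dist x y (\<lambda>a. if x \<le> y then x + a else x - a)"
      by (auto simp: geodesic_path_def dist_real_def)
    then show ?thesis by (auto simp: geodesic_segment_def)
  qed
  then have "geodesic_space UNIV (dist :: real \<Rightarrow> real \<Rightarrow> real)"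
    by (simp add: geodesic_space_def Met_TC.Metric_space_axioms)
  moreover have "\<exists>q\<in>A \<union> B. dist p q \<le> 0"
    if "geodesic_segment UNIV dist x y A" "geodesic_segment UNIV dist y z B"
      "geodesic_segment UNIV dist x z C" "p \<in> C" for x y z p :: real and A B C
  proof -
    have "p \<in> A \<union> B"
      using that by (auto dest!: geodesic_segment_real simp: min_def max_def split: if_splits)
    then show ?thesis by force
  qed
  ultimately show ?thesis
    unfolding hyperbolic_space_def by (intro conjI exI[of _ 0]) blast+
qed

section \<open>A missing edge yields a loxodromic element\<close>

lemma loxodromic_translation:
  fixes \<phi> :: "'g \<Rightarrow> real \<Rightarrow> real"
  assumes "group G" and act: "group_action G UNIV \<phi>" and g: "g \<in> carrier G"
    and tr: "\<And>x. \<phi> g x = x - 1"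
  shows "loxodromic G UNIV dist \<phi> g"
proof -
  interpret group G by fact
  interpret group_action G UNIV \<phi> by fact
  define F where "F n = \<phi> (g [^]\<^bsub>G\<^esub> n) 0" for n :: int
  have step: "F (1 + n) = F n - 1" for n
  proof -
    have "g [^]\<^bsub>G\<^esub> (1 + n) = g \<otimes>\<^bsub>G\<^esub> g [^]\<^bsub>G\<^esub> n"
      using int_pow_mult[OF g, of 1 n] g by (simp add: int_pow_1)
    then show ?thesis
      unfolding F_def using composition_rule[OF UNIV_I g int_pow_closed[OF g]] tr by simp
  qed
  have "F n = - of_int n" for n
  proof (induction n rule: int_induct[where k = 0])
    case base
    show ?case unfolding F_def using id_eq_one
      by (metis UNIV_I int_pow_0 of_int_0 neg_0_equal_iff_equal restrict_apply')
  next
    case (step1 i)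
    then show ?case using step[of i] by (simp add: add.commute)
  next
    case (step2 i)
    then show ?case using step[of "i - 1"] by simp
  qed
  then have "dist (F a) (F b) = real_of_int \<bar>a - b\<bar>" for a b
    by (simp add: dist_real_def)
  then have "quasi_isometric_embedding UNIV (dist :: int \<Rightarrow> int \<Rightarrow> real) UNIV dist F"
    unfolding quasi_isometric_embedding_def by (auto simp: dist_of_int intro!: exI[of _ 1])
  then show ?thesis unfolding loxodromic_def F_def by blast
qed

lemma right_angled_non_edge_not_NL:
  assumes graph: "coxeter_graph V E m" and ra: "right_angled E m"
    and st: "s \<in> V" "t \<in> V" "s \<noteq> t" "{s, t} \<notin> E"
  shows "\<not> property_NL TYPE(real) (coxeter_group V E m)"
proof -
  \<comment> \<open>The composition of the reflections \<open>x \<mapsto> 1 - x\<close> and \<open>x \<mapsto> - x\<close> is the translation by \<open>-1\<close>.\<close>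
  define f :: "_ \<Rightarrow> real \<Rightarrow> real"
    where "f v x = (if v = s then - x else if v = t then 1 - x else x)" for v x
  let ?R = "coxeter_relators V E m"
  let ?G = "coxeter_group V E m"
  note R = coxeter_relators_subset_words[OF graph]
  have invol: "f v (f v x) = x" for v x by (simp add: f_def)
  have bij: "bij (f v)" for v using invol by (metis involuntory_imp_bij)
  have iso: "dist (f v x) (f v y) = dist x y" for v x y
    by (auto simp: f_def dist_real_def)
  \<comment> \<open>One of the two ends of an edge acts trivially.\<close>
  have comm: "f u (f v (f u (f v x))) = x" if "{u, v} \<in> E" for u v x
  proof -
    have "card {u, v} = 2" using that graph unfolding coxeter_graph_def by blast
    then have "u \<noteq> v" by auto
    moreover have "{u, v} \<noteq> {s, t}" using that st(4) by metis
    ultimately have "u \<notin> {s, t} \<or> v \<notin> {s, t}" by auto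
    then have "f u = id \<or> f v = id" by (auto simp: f_def fun_eq_iff)
    then show ?thesis using invol by auto
  qed
  have rel: "word_action f r = id" if r: "r \<in> ?R" for r
  proof -
    consider (sq) v where "r = [(v, True), (v, True)]"
      | (edge) u v where "{u, v} \<in> E" "r = concat (replicate (m {u, v}) [(u, True), (v, True)])"
      using r unfolding coxeter_relators_def by blast
    then show ?thesis
    proof cases
      case sq
      then show ?thesis by (simp add: word_action_Cons word_action_Nil fun_eq_iff invol)
    next
      case edge
      have "m {u, v} = Suc (Suc 0)" using edge(1) ra by (simp add: right_angled_def)
      then show ?thesis using edge
        by (simp add: word_action_Cons word_action_Nil fun_eq_iff comm)
    qed
  qed
  let ?\<phi> = "presented_action f"
  let ?g = "presentation_rel V ?R `` {[(s, True), (t, True)]}"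
  have w: "[(s, True), (t, True)] \<in> words V" using st by (simp add: words_def)
  have act: "isometric_action ?G UNIV dist ?\<phi>"
    unfolding coxeter_group_def by (rule isometric_action_presented_group[OF R bij iso rel])
  have g: "?g \<in> carrier ?G"
    using w by (simp add: coxeter_group_def presented_group_def quotientI)
  have "?\<phi> ?g x = x - 1" for x
    using presented_action_class[OF R bij rel w] st(3)
    by (simp add: word_action_Cons word_action_Nil f_def)
  then have "loxodromic ?G UNIV dist ?\<phi> ?g"
    using loxodromic_translation[OF group_coxeter_group[OF graph] _ g] act
    by (simp add: isometric_action_def)
  then show ?thesis
    unfolding property_NL_def using hyperbolic_space_real act g by blast
qed

theorem corollary3:
  fixes V :: "'v set" and E :: "'v set set" and m :: "'v set \<Rightarrow> nat"
  assumes "coxeter_graph V E m"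
    and "right_angled E m"
  shows "(property_NL TYPE(real) (coxeter_group V E m) \<longleftrightarrow> finite (carrier (coxeter_group V E m)))
       \<and> (finite (carrier (coxeter_group V E m)) \<longrightarrow> property_NL TYPE('x) (coxeter_group V E m))"
proof -
  let ?G = "coxeter_group V E m"
  note fin = finite_property_NL[OF group_coxeter_group[OF assms(1)]]
  have "finite (carrier ?G)" if "property_NL TYPE(real) ?G"
  proof (rule right_angled_complete_finite[OF assms])
    fix s t assume "s \<in> V" "t \<in> V" "s \<noteq> t"
    then show "{s, t} \<in> E" using right_angled_non_edge_not_NL[OF assms] that by metis
  qed
  then show ?thesis using fin by metis
qed

end
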